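(* Let $G=(V,E)$ be a locally finite graph and $s\colon E\to\{-1,1\}$ a sign function. If the signed voter model on $(G,s)$ has a unique equilibrium, then the signed voter model on $(G,s)$ is ergodic.
   Context: All graphs are simple, with countable vertex set and with every vertex $x$ of finite degree $d(x)\ge 1$. Given $G=(V,E)$ and $s\colon E\to\{-1,1\}$ (write $s(x,y)=s(\{x,y\})$), the signed voter model $(\eta_t)_{t\ge0}$ is the spin system (Feller Markov process) on $\{-1,1\}^V$ with generator $$\Omega f(\eta)=\sum_{x\in V}\big(f(\eta^x)-f(\eta)\big)\frac1{d(x)}\sum_{y\colon\{x,y\}\in E}1\{\eta(x)\eta(y)\ne s(x,y)\},$$ where $\eta^x$ is $\eta$ with the spin at $x$ flipped. An equilibrium is an invariant (stationary) probability measure of this process on $\{-1,1\}^V$. The process is ergodic if there is a unique equilibrium $\mu$ and, for every initial configuration $\eta_0\in\{-1,1\}^V$, $\eta_t$ converges in distribution to $\mu$ as $t\to\infty$. *)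

theory Defs
  imports "HOL-Probability.Probability"
begin

(* The vertex set is the whole type 'v; edges are two-element sets of vertices. *)

definition neighbours :: "'v set set \<Rightarrow> 'v \<Rightarrow> 'v set" where
  "neighbours E x = {y. {x, y} \<in> E}"

definition vertex_degree :: "'v set set \<Rightarrow> 'v \<Rightarrow> nat" where
  "vertex_degree E x = card (neighbours E x)"

definition locally_finite_graph :: "'v set set \<Rightarrow> bool" where
  "locally_finite_graph E \<longleftrightarrow>
     (\<forall>e\<in>E. card e = 2) \<and>
     (\<forall>x. finite (neighbours E x) \<and> vertex_degree E x \<ge> 1)"

definition sign_function :: "'v set set \<Rightarrow> ('v set \<Rightarrow> real) \<Rightarrow> bool" where
  "sign_function E s \<longleftrightarrow> (\<forall>e\<in>E. s e \<in> {-1, 1})"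

definition configs :: "('v \<Rightarrow> real) set" where
  "configs = {\<eta>. \<forall>x. \<eta> x \<in> {-1, 1}}"

(* As a subspace of 'v => real with its product topology, configs carries the product
   of the discrete topologies on {-1,1}; for countable 'v the Borel sets are the
   product sigma-algebra. *)
definition config_space :: "('v \<Rightarrow> real) measure" where
  "config_space = restrict_space borel configs"

definition flip :: "('v \<Rightarrow> real) \<Rightarrow> 'v \<Rightarrow> ('v \<Rightarrow> real)" where
  "flip \<eta> x = \<eta>(x := - \<eta> x)"

definition flip_rate :: "'v set set \<Rightarrow> ('v set \<Rightarrow> real) \<Rightarrow> 'v \<Rightarrow> ('v \<Rightarrow> real) \<Rightarrow> real" where
  "flip_rate E s x \<eta> =
     1 / real (vertex_degree E x) *
     (\<Sum>y\<in>neighbours E x. of_bool (\<eta> x * \<eta> y \<noteq> s {x, y}))"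

definition cylinder :: "(('v \<Rightarrow> real) \<Rightarrow> real) \<Rightarrow> bool" where
  "cylinder f \<longleftrightarrow>
     (\<exists>A. finite A \<and> (\<forall>\<eta>\<in>configs. \<forall>\<zeta>\<in>configs. (\<forall>x\<in>A. \<eta> x = \<zeta> x) \<longrightarrow> f \<eta> = f \<zeta>))"

(* Used on cylinder functions only, where all but finitely many summands vanish. *)
definition pregenerator ::
    "'v set set \<Rightarrow> ('v set \<Rightarrow> real) \<Rightarrow> (('v \<Rightarrow> real) \<Rightarrow> real) \<Rightarrow> ('v \<Rightarrow> real) \<Rightarrow> real" where
  "pregenerator E s f \<eta> = (\<Sum>\<^sub>\<infinity>x. (f (flip \<eta> x) - f \<eta>) * flip_rate E s x \<eta>)"

(* (f, g) is in the graph of the sup-norm closure of the operator above with the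
   cylinder functions as its domain. *)
definition in_pregenerator_closure ::
    "'v set set \<Rightarrow> ('v set \<Rightarrow> real) \<Rightarrow> (('v \<Rightarrow> real) \<Rightarrow> real) \<Rightarrow> (('v \<Rightarrow> real) \<Rightarrow> real) \<Rightarrow> bool" where
  "in_pregenerator_closure E s f g \<longleftrightarrow>
     (\<exists>F. (\<forall>n. cylinder (F n)) \<and>
          uniform_limit configs F f sequentially \<and>
          uniform_limit configs (\<lambda>n. pregenerator E s (F n)) g sequentially)"

(* A process is given by its transition function: K t \<eta> is the law at time t
   of the process started from \<eta>. Only t \<ge> 0 and \<eta> \<in> configs matter. *)
type_synonym 'v transition = "real \<Rightarrow> ('v \<Rightarrow> real) \<Rightarrow> ('v \<Rightarrow> real) measure"

definition transition_op :: "'v transition \<Rightarrow> real \<Rightarrow> (('v \<Rightarrow> real) \<Rightarrow> real) \<Rightarrow> ('v \<Rightarrow> real) \<Rightarrow> real" where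
  "transition_op K t f \<eta> = (\<integral>\<zeta>. f \<zeta> \<partial>K t \<eta>)"

definition feller_process :: "'v transition \<Rightarrow> bool" where
  "feller_process K \<longleftrightarrow>
     (\<forall>t\<ge>0. K t \<in> config_space \<rightarrow>\<^sub>M prob_algebra config_space) \<and>
     (\<forall>\<eta>\<in>configs. K 0 \<eta> = return config_space \<eta>) \<and>
     (\<forall>t\<ge>0. \<forall>u\<ge>0. \<forall>\<eta>\<in>configs. K (t + u) \<eta> = K t \<eta> \<bind> K u) \<and>
     (\<forall>f. continuous_on configs f \<longrightarrow>
        (\<forall>t\<ge>0. continuous_on configs (transition_op K t f)) \<and>
        uniform_limit configs (\<lambda>t. transition_op K t f) f (at_right 0))"

definition in_generator ::
    "'v transition \<Rightarrow> (('v \<Rightarrow> real) \<Rightarrow> real) \<Rightarrow> (('v \<Rightarrow> real) \<Rightarrow> real) \<Rightarrow> bool" where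
  "in_generator K f g \<longleftrightarrow>
     continuous_on configs f \<and> continuous_on configs g \<and>
     uniform_limit configs (\<lambda>t \<eta>. (transition_op K t f \<eta> - f \<eta>) / t) g (at_right 0)"

(* The infinitesimal generator of the process is the closure of the pregenerator; by
   the Hille-Yosida theorem this determines K t \<eta> for t \<ge> 0 and \<eta> \<in> configs. *)
definition signed_voter_model ::
    "'v set set \<Rightarrow> ('v set \<Rightarrow> real) \<Rightarrow> 'v transition \<Rightarrow> bool" where
  "signed_voter_model E s K \<longleftrightarrow>
     feller_process K \<and> (\<forall>f g. in_generator K f g \<longleftrightarrow> in_pregenerator_closure E s f g)"

definition equilibrium :: "'v transition \<Rightarrow> ('v \<Rightarrow> real) measure \<Rightarrow> bool" where
  "equilibrium K \<mu> \<longleftrightarrow>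
     \<mu> \<in> space (prob_algebra config_space) \<and> (\<forall>t\<ge>0. \<mu> \<bind> K t = \<mu>)"

definition converges_in_distribution ::
    "(real \<Rightarrow> ('v \<Rightarrow> real) measure) \<Rightarrow> ('v \<Rightarrow> real) measure \<Rightarrow> bool" where
  "converges_in_distribution \<nu> \<mu> \<longleftrightarrow>
     (\<forall>f::('v \<Rightarrow> real) \<Rightarrow> real. continuous_on configs f \<and> bounded (f ` configs) \<longrightarrow>
        ((\<lambda>t. \<integral>\<zeta>. f \<zeta> \<partial>\<nu> t) \<longlongrightarrow> (\<integral>\<zeta>. f \<zeta> \<partial>\<mu>)) at_top)"

definition ergodic :: "'v transition \<Rightarrow> bool" where
  "ergodic K \<longleftrightarrow>
     (\<exists>\<mu>. equilibrium K \<mu> \<and> (\<forall>\<nu>. equilibrium K \<nu> \<longrightarrow> \<nu> = \<mu>) \<and>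
        (\<forall>\<eta>\<^sub>0\<in>configs. converges_in_distribution (\<lambda>t. K t \<eta>\<^sub>0) \<mu>))"

end

theory Submission
  imports Defs "HOL-Real_Asymp.Real_Asymp"
begin

text \<open>
  Write \<open>U\<^sub>t f \<eta> = \<integral> f d(K t \<eta>)\<close> for the semigroup and \<open>\<Omega>\<close> for the pregenerator. The theorem follows from the
  assertion that the law at time \<open>t\<close> changes less and less with time: for every initial
  configuration \<open>\<eta>\<close>, every cylinder function \<open>f\<close> and every \<open>h \<ge> 0\<close>,
  \<open>U\<^sub>t\<^sub>+\<^sub>h f \<eta> - U\<^sub>t f \<eta> \<rightarrow> 0\<close> as \<open>t \<rightarrow> \<infinity>\<close> (\<open>transition_op_asymptotically_constant\<close>). Granted this, every limit point
  \<open>\<nu>\<close> of the laws \<open>K t \<eta>\<close> satisfies \<open>\<integral> U\<^sub>h f d\<nu> = \<integral> f d\<nu>\<close> for all cylinder functions, so it is an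
  equilibrium (\<open>limit_of_laws_is_equilibrium\<close>); no averaging over time is involved. The laws live on a
  compact space, so any sequence of times tending to infinity has a subsequence along which they
  converge (\<open>laws_sequentially_compact\<close>). If there is only one equilibrium, all these limits agree and
  the laws converge to it.

  The decay of the increments rests on duality. At rate \<open>1\<close> the vertex \<open>x\<close> picks a uniform neighbour
  \<open>y\<close> and sets its spin to \<open>s {x, y} * \<eta> y\<close>. If \<open>f\<close> depends on the spins in a finite set \<open>A\<close>, its value
  after this update depends on the spins in \<open>(A - {x}) \<union> {y}\<close>, a set that is no larger than \<open>A\<close>. Seen
  from \<open>f\<close>, the process is therefore a system of at most \<open>n = card A\<close> coalescing random walks, whose
  total jump rate is at most \<open>n\<close> although infinitely many spins may flip in every time interval. Hence
  for \<open>N \<ge> n\<close> the operator \<open>1 + \<Omega> / N\<close> is an average over functions of at most \<open>n\<close> spins, and the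
  functions \<open>g\<^sub>k = (1 + \<Omega> / N)\<^sup>k f\<close> are bounded uniformly in \<open>k\<close> (\<open>few_spins_uniformised_step\<close>).
  The numbers \<open>a\<^sub>k(t) = U\<^sub>t g\<^sub>k \<eta>\<close> solve \<open>a\<^sub>k' = N (a\<^sub>k\<^sub>+\<^sub>1 - a\<^sub>k)\<close>, so \<open>a\<^sub>0(t)\<close> is the mean of \<open>a\<^sub>X(0)\<close> for a
  Poisson variable \<open>X\<close> with mean \<open>N t\<close>. A Poisson law with a large mean is nearly invariant under
  the shift by one, which gives \<open>\<bar>a\<^sub>0'(t)\<bar> = O(1 / sqrt t)\<close>.
\<close>

section \<open>Poisson averages of bounded sequences\<close>

lemma exp_sums_real: "(\<lambda>m. x ^ m / fact m) sums exp (x::real)"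
  using exp_converges[of x] by (simp add: divide_inverse mult.commute)

text \<open>The identity \<open>\<E>[X b(X - 1)] = x \<E>[b(X)]\<close> for a Poisson variable \<open>X\<close> with mean \<open>x\<close>, without the
  normalising factor \<open>exp (- x)\<close>. It yields the Poisson moments and turns a shift of the index into
  a weight.\<close>

lemma sums_index_times_exp_terms:
  fixes x :: real
  shows "((\<lambda>m. b m * (x ^ m / fact m)) sums S) \<Longrightarrow>
     ((\<lambda>m. real m * b (m - 1) * (x ^ m / fact m)) sums (x * S))"
proof -
  assume S: "(\<lambda>m. b m * (x ^ m / fact m)) sums S"
  define f where "f m = real m * b (m - 1) * (x ^ m / fact m)" for m
  have "f (Suc m) = x * (b m * (x ^ m / fact m))" for m
    by (simp add: f_def field_simps del: of_nat_Suc)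
  then have "(\<lambda>m. f (Suc m)) sums (x * S)" using sums_mult[OF S, of x] by simp
  then have "f sums (x * S + f 0)" by (simp only: sums_Suc_iff)
  then show ?thesis by (simp add: f_def[abs_def])
qed

lemma poisson_variance_sums:
  fixes x :: real
  shows "(\<lambda>m. (real m - x)\<^sup>2 * (x ^ m / fact m)) sums (x * exp x)"
proof -
  have 0: "(\<lambda>m. 1 * (x ^ m / fact m)) sums exp x" using exp_sums_real by simp
  have 1: "(\<lambda>m. real m * 1 * (x ^ m / fact m)) sums (x * exp x)"
    by (rule sums_index_times_exp_terms[OF 0])
  then have "(\<lambda>m. real m * (x ^ m / fact m)) sums (x * exp x)" by simp
  from sums_index_times_exp_terms[OF this]
  have 2: "(\<lambda>m. real m * real (m - 1) * (x ^ m / fact m)) sums (x * (x * exp x))" .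
  have "(\<lambda>m. real m * real (m - 1) * (x ^ m / fact m) + (1 - 2 * x) * (real m * 1 * (x ^ m / fact m))
            + x\<^sup>2 * (1 * (x ^ m / fact m)))
        sums (x * (x * exp x) + (1 - 2 * x) * (x * exp x) + x\<^sup>2 * exp x)"
    by (intro sums_add sums_mult 0 1 2)
  moreover have "real m * real (m - 1) * (x ^ m / fact m) + (1 - 2 * x) * (real m * 1 * (x ^ m / fact m))
            + x\<^sup>2 * (1 * (x ^ m / fact m)) = (real m - x)\<^sup>2 * (x ^ m / fact m)" for m
  proof -
    have "real m * real (m - 1) = real m * real m - real m" by (cases m) (auto simp: algebra_simps)
    then have "real m * real (m - 1) + (1 - 2 * x) * (real m * 1) + x\<^sup>2 * 1 = (real m - x)\<^sup>2"
      by (simp add: algebra_simps power2_eq_square)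
    then show ?thesis by (metis (no_types, lifting) distrib_right mult.assoc)
  qed
  moreover have "x * (x * exp x) + (1 - 2 * x) * (x * exp x) + x\<^sup>2 * exp x = x * exp x"
    by (simp add: algebra_simps power2_eq_square)
  ultimately show ?thesis by simp
qed

text \<open>The Poisson law with mean \<open>x\<close> is within \<open>1 / sqrt x\<close> of its shift by one: by the preceding
  identity, \<open>\<E>[\<alpha>(X + 1) - \<alpha>(X)] = \<E>[\<alpha>(X) (X - x)] / x\<close>, and the mean absolute deviation of \<open>X\<close> is
  at most its standard deviation \<open>sqrt x\<close>.\<close>

lemma poisson_average_of_increments:
  fixes \<alpha> :: "nat \<Rightarrow> real"
  assumes x: "x > 0" and c: "\<And>m. \<bar>\<alpha> m\<bar> \<le> c"
    and S: "(\<lambda>m. (\<alpha> (Suc m) - \<alpha> m) * (x ^ m / fact m)) sums S"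
  shows "\<bar>S\<bar> \<le> c * exp x / sqrt x"
proof -
  have c0: "c \<ge> 0" using c[of 0] by linarith
  have summ: "summable (\<lambda>m. \<alpha> m * (x ^ m / fact m))"
  proof (rule summable_comparison_test')
    show "summable (\<lambda>m. c * (x ^ m / fact m))"
      by (intro summable_mult) (use exp_sums_real in \<open>blast intro: sums_summable\<close>)
    show "norm (\<alpha> m * (x ^ m / fact m)) \<le> c * (x ^ m / fact m)" if "m \<ge> 0" for m
    proof -
      have "norm (\<alpha> m * (x ^ m / fact m)) = \<bar>\<alpha> m\<bar> * (x ^ m / fact m)" using x by (simp add: abs_mult)
      also have "\<dots> \<le> c * (x ^ m / fact m)" using c[of m] x by (intro mult_right_mono) auto
      finally show ?thesis .
    qed
  qed
  then obtain T where T: "(\<lambda>m. \<alpha> m * (x ^ m / fact m)) sums T" by (auto simp: summable_def)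
  have "(\<lambda>m. (\<alpha> (Suc m) - \<alpha> m) * (x ^ m / fact m) + \<alpha> m * (x ^ m / fact m)) sums (S + T)"
    by (intro sums_add S T)
  then have "(\<lambda>m. \<alpha> (Suc m) * (x ^ m / fact m)) sums (S + T)"
    by (simp only: left_diff_distrib diff_add_cancel)
  from sums_index_times_exp_terms[OF this]
  have "(\<lambda>m. real m * \<alpha> (Suc (m - 1)) * (x ^ m / fact m)) sums (x * (S + T))" .
  moreover have "real m * \<alpha> (Suc (m - 1)) = real m * \<alpha> m" for m by (cases m) auto
  ultimately have "(\<lambda>m. real m * \<alpha> m * (x ^ m / fact m)) sums (x * (S + T))" by (simp only:)
  from sums_diff[OF this sums_mult[OF T, of x]]
  have xS: "(\<lambda>m. \<alpha> m * (real m - x) * (x ^ m / fact m)) sums (x * S)"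
    by (simp add: algebra_simps)
  \<comment> \<open>\<open>\<bar>u\<bar> \<le> (sqrt x + u\<^sup>2 / sqrt x) / 2\<close> replaces the Cauchy-Schwarz inequality for the Poisson law:
    with \<open>u = m - x\<close> the bound can be summed in closed form.\<close>
  define D where "D m = c * (sqrt x / 2 * (x ^ m / fact m) + 1 / (2 * sqrt x) * ((real m - x)\<^sup>2 * (x ^ m / fact m)))" for m
  have D: "D sums (c * (sqrt x / 2 * exp x + 1 / (2 * sqrt x) * (x * exp x)))"
    unfolding D_def by (intro sums_mult sums_add exp_sums_real poisson_variance_sums)
  have amgm: "\<bar>u\<bar> \<le> sqrt x / 2 + 1 / (2 * sqrt x) * u\<^sup>2" for u :: real
  proof -
    have "0 \<le> (\<bar>u\<bar> - sqrt x)\<^sup>2 / (2 * sqrt x)" using x by simp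
    also have "\<dots> = sqrt x / 2 + 1 / (2 * sqrt x) * u\<^sup>2 - \<bar>u\<bar>"
      using x by (simp add: power2_eq_square field_simps)
    finally show ?thesis by simp
  qed
  have le: "\<bar>\<alpha> m * (real m - x) * (x ^ m / fact m)\<bar> \<le> D m" for m
  proof -
    have "\<bar>\<alpha> m * (real m - x) * (x ^ m / fact m)\<bar> = \<bar>\<alpha> m\<bar> * (\<bar>real m - x\<bar> * (x ^ m / fact m))"
      using x by (simp add: abs_mult)
    also have "\<dots> \<le> c * ((sqrt x / 2 + 1 / (2 * sqrt x) * (real m - x)\<^sup>2) * (x ^ m / fact m))"
      using x by (intro mult_mono c amgm) (auto intro!: c0)
    also have "\<dots> = D m" by (simp add: D_def algebra_simps)
    finally show ?thesis .
  qed
  have "x * S \<le> c * (sqrt x / 2 * exp x + 1 / (2 * sqrt x) * (x * exp x))"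
    by (rule sums_le[OF _ xS D]) (use le in \<open>meson abs_le_D1\<close>)
  moreover have "- (c * (sqrt x / 2 * exp x + 1 / (2 * sqrt x) * (x * exp x))) \<le> x * S"
    by (rule sums_le[OF _ sums_minus[OF D] xS]) (use le in \<open>meson abs_le_iff minus_le_iff\<close>)
  moreover have "c * (sqrt x / 2 * exp x + 1 / (2 * sqrt x) * (x * exp x)) = x * (c * exp x / sqrt x)"
  proof -
    have "x = sqrt x * sqrt x" using x by simp
    then show ?thesis using x by (simp add: field_simps)
  qed
  ultimately have "\<bar>x * S\<bar> \<le> x * (c * exp x / sqrt x)"
    by (metis abs_le_iff minus_le_iff)
  then have "x * \<bar>S\<bar> \<le> x * (c * exp x / sqrt x)" using x by (simp add: abs_mult)
  then show ?thesis using x by (rule mult_left_le_imp_le)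
qed

text \<open>With \<open>b\<^sub>k(t) = exp (N t) a\<^sub>k(t)\<close> the differential equations become \<open>b\<^sub>k' = N b\<^sub>k\<^sub>+\<^sub>1\<close>, so all Taylor
  coefficients of \<open>b\<^sub>k\<close> at \<open>0\<close> are known, and the uniform bound on the \<open>a\<^sub>k\<close> makes the remainder vanish.\<close>

lemma poissonised_sequence_formula:
  fixes a :: "nat \<Rightarrow> real \<Rightarrow> real"
  assumes N: "N > 0" and t: "t > 0"
    and deriv: "\<And>k u. u \<ge> 0 \<Longrightarrow> (a k has_real_derivative N * (a (Suc k) u - a k u)) (at u)"
    and bound: "\<And>k u. u \<ge> 0 \<Longrightarrow> \<bar>a k u\<bar> \<le> c"
  shows "(\<lambda>m. a (k + m) 0 * ((N * t) ^ m / fact m)) sums (exp (N * t) * a k t)"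
proof -
  define diff where "diff m u = N ^ m * (exp (N * u) * a (k + m) u)" for m u
  have d: "DERIV (diff m) u :> diff (Suc m) u" if "u \<ge> 0" for m u
    unfolding diff_def
    by (rule derivative_eq_intros deriv[OF that] refl | simp add: algebra_simps)+
  have c0: "c \<ge> 0" using bound[of 0 0] by linarith
  define R where "R n = exp (N * t) * a k t - (\<Sum>m<n. a (k + m) 0 * ((N * t) ^ m / fact m))" for n
  have R: "\<bar>R n\<bar> \<le> c * exp (N * t) * ((N * t) ^ n / fact n)" if n: "n > 0" for n
  proof -
    from Maclaurin[OF t n, of diff "diff 0"] d
    obtain v where v: "0 < v" "v < t" and
      eq: "diff 0 t = (\<Sum>m<n. diff m 0 / fact m * t ^ m) + diff n v / fact n * t ^ n"
      by auto
    have "R n = diff n v / fact n * t ^ n"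
      using eq by (simp add: R_def diff_def power_mult_distrib algebra_simps)
    also have "\<dots> = a (k + n) v * exp (N * v) * ((N * t) ^ n / fact n)"
      by (simp add: diff_def power_mult_distrib)
    finally have "\<bar>R n\<bar> = \<bar>a (k + n) v\<bar> * exp (N * v) * ((N * t) ^ n / fact n)"
      using N t by (simp add: abs_mult)
    also have "\<dots> \<le> c * exp (N * t) * ((N * t) ^ n / fact n)"
      using N t v by (intro mult_mono bound) (auto intro!: c0 mult_nonneg_nonneg)
    finally show ?thesis .
  qed
  have "(\<lambda>n. c * exp (N * t) * ((N * t) ^ n / fact n)) \<longlonglongrightarrow> c * exp (N * t) * 0"
    by (intro tendsto_mult tendsto_const summable_LIMSEQ_zero)
       (use exp_sums_real in \<open>blast intro: sums_summable\<close>)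
  then have "(\<lambda>n. c * exp (N * t) * ((N * t) ^ n / fact n)) \<longlonglongrightarrow> 0" by simp
  then have "R \<longlonglongrightarrow> 0"
    by (rule Lim_null_comparison[rotated]) (use R in \<open>auto intro!: eventually_sequentiallyI[of 1]\<close>)
  from tendsto_diff[OF tendsto_const[of "exp (N * t) * a k t"] this]
  show ?thesis by (simp add: sums_def R_def)
qed

lemma poissonised_sequence_increment:
  fixes a :: "nat \<Rightarrow> real \<Rightarrow> real"
  assumes N: "N > 0" and t: "t > 0"
    and deriv: "\<And>k u. u \<ge> 0 \<Longrightarrow> (a k has_real_derivative N * (a (Suc k) u - a k u)) (at u)"
    and bound: "\<And>k u. u \<ge> 0 \<Longrightarrow> \<bar>a k u\<bar> \<le> c"
  shows "\<bar>a 1 t - a 0 t\<bar> \<le> c / sqrt (N * t)"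
proof -
  note sum = poissonised_sequence_formula[of N t a c, OF N t deriv bound]
  have "(\<lambda>m. a (1 + m) 0 * ((N * t) ^ m / fact m) - a (0 + m) 0 * ((N * t) ^ m / fact m))
     sums (exp (N * t) * a 1 t - exp (N * t) * a 0 t)"
    by (intro sums_diff sum)
  then have "(\<lambda>m. (a (Suc m) 0 - a m 0) * ((N * t) ^ m / fact m)) sums (exp (N * t) * (a 1 t - a 0 t))"
    by (simp only: left_diff_distrib right_diff_distrib add_0 plus_1_eq_Suc)
  from poisson_average_of_increments[OF _ _ this, of c] N t bound
  have "exp (N * t) * \<bar>a 1 t - a 0 t\<bar> \<le> exp (N * t) * (c / sqrt (N * t))"
    by (simp add: abs_mult mult.commute)
  then show ?thesis by (rule mult_left_le_imp_le) simp
qed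

text \<open>Derivatives are required only at positive times, where they are two-sided for a semigroup; the
  proof therefore expands from time \<open>1\<close> instead of time \<open>0\<close>.\<close>

lemma poissonised_sequence_asymptotically_constant:
  fixes a :: "nat \<Rightarrow> real \<Rightarrow> real"
  assumes N: "N > 0" and h: "h \<ge> 0"
    and deriv: "\<And>k u. u > 0 \<Longrightarrow> (a k has_real_derivative N * (a (Suc k) u - a k u)) (at u)"
    and bound: "\<And>k u. u \<ge> 0 \<Longrightarrow> \<bar>a k u\<bar> \<le> c"
  shows "((\<lambda>t. a 0 (t + h) - a 0 t) \<longlongrightarrow> 0) at_top"
proof -
  have c0: "c \<ge> 0" using bound[of 0 0] by linarith
  have inc: "\<bar>a 1 u - a 0 u\<bar> \<le> c / sqrt (N * (u - 1))" if "u > 1" for u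
  proof -
    have "((\<lambda>v. a k (v + 1)) has_real_derivative N * (a (Suc k) (v + 1) - a k (v + 1))) (at v)"
      if "v \<ge> 0" for k v
      using deriv[of "v + 1" k] that by (simp add: DERIV_shift)
    from poissonised_sequence_increment[where a = "\<lambda>k v. a k (v + 1)", OF N _ this bound, of "u - 1"] that
    show ?thesis by simp
  qed
  have le: "\<bar>a 0 (t + h) - a 0 t\<bar> \<le> h * N * c / sqrt (N * (t - 1))" if t: "t > 1" for t
  proof (cases "h = 0")
    case False
    then have "t < t + h" using h by simp
    from MVT2[OF this, of "a 0" "\<lambda>u. N * (a (Suc 0) u - a 0 u)"] deriv t
    obtain u where u: "t < u" and eq: "a 0 (t + h) - a 0 t = h * (N * (a 1 u - a 0 u))"
      by auto
    have "\<bar>a 1 u - a 0 u\<bar> \<le> c / sqrt (N * (t - 1))"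
    proof (rule order_trans[OF inc])
      show "c / sqrt (N * (u - 1)) \<le> c / sqrt (N * (t - 1))"
        using u t N c0 by (intro divide_left_mono) auto
    qed (use u t in auto)
    then have "h * N * \<bar>a 1 u - a 0 u\<bar> \<le> h * N * (c / sqrt (N * (t - 1)))"
      using h N by (intro mult_left_mono) auto
    then show ?thesis using h N by (simp add: eq abs_mult)
  qed simp
  have "((\<lambda>t. h * N * c / sqrt (N * (t - 1))) \<longlongrightarrow> 0) at_top"
    using N by real_asymp
  then show ?thesis
    by (rule Lim_null_comparison[rotated])
       (use le in \<open>auto intro!: eventually_mono[OF eventually_gt_at_top[of 1]]\<close>)
qed

section \<open>Sequential compactness of the laws of spin configurations\<close>

lemma compact_configs: "compact (configs :: ('v \<Rightarrow> real) set)"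
proof -
  have "configs = (PiE UNIV (\<lambda>_::'v. {-1, 1::real}))"
    by (auto simp: configs_def)
  then have "compactin (product_topology (\<lambda>_::'v. euclidean::real topology) UNIV) configs"
    by (metis compactin_PiE compactin_euclidean_iff finite.emptyI finite.insertI finite_imp_compact)
  then show ?thesis by (simp add: euclidean_product_topology)
qed

lemma configs_nonempty: "configs \<noteq> {}"
  by (auto simp: configs_def intro!: exI[of _ "\<lambda>_. 1"])

lemma space_config_space [simp]: "space config_space = configs"
  by (simp add: config_space_def space_restrict_space)

lemma continuous_imp_config_measurable:
  "continuous_on configs f \<Longrightarrow> f \<in> borel_measurable config_space"
  unfolding config_space_def by (rule borel_measurable_continuous_on_restrict)

lemma continuous_configs_bounded:
  fixes f :: "('v \<Rightarrow> real) \<Rightarrow> real"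
  assumes "continuous_on configs f"
  obtains B where "B \<ge> 0" "\<And>\<eta>. \<eta> \<in> configs \<Longrightarrow> \<bar>f \<eta>\<bar> \<le> B"
proof -
  have "bounded (f ` configs)"
    using compact_continuous_image[OF assms compact_configs] by (rule compact_imp_bounded)
  then obtain B where "\<And>\<eta>. \<eta> \<in> configs \<Longrightarrow> \<bar>f \<eta>\<bar> \<le> B"
    by (auto simp: bounded_iff)
  then show ?thesis using that[of "\<bar>B\<bar>"] by (meson abs_ge_self abs_ge_zero order_trans)
qed

lemma law_integrable:
  fixes f :: "('v \<Rightarrow> real) \<Rightarrow> real"
  assumes \<nu>: "\<nu> \<in> space (prob_algebra config_space)" and f: "continuous_on configs f"
  shows "integrable \<nu> f"
proof -
  interpret prob_space \<nu> using \<nu> by (simp add: space_prob_algebra)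
  have s: "sets \<nu> = sets config_space" using \<nu> by (simp add: space_prob_algebra)
  obtain B where "\<And>\<eta>. \<eta> \<in> configs \<Longrightarrow> \<bar>f \<eta>\<bar> \<le> B" using continuous_configs_bounded[OF f] by blast
  then show ?thesis
    using continuous_imp_config_measurable[OF f] sets_eq_imp_space_eq[OF s]
    by (intro integrable_const_bound[of _ B] AE_I2) (auto simp: measurable_cong_sets[OF s refl])
qed

lemma law_integral_le:
  fixes f :: "('v \<Rightarrow> real) \<Rightarrow> real"
  assumes \<nu>: "\<nu> \<in> space (prob_algebra config_space)" and f: "continuous_on configs f"
    and le: "\<And>\<eta>. \<eta> \<in> configs \<Longrightarrow> \<bar>f \<eta>\<bar> \<le> c"
  shows "\<bar>\<integral>\<eta>. f \<eta> \<partial>\<nu>\<bar> \<le> c"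
proof -
  interpret prob_space \<nu> using \<nu> by (simp add: space_prob_algebra)
  have s: "sets \<nu> = sets config_space" using \<nu> by (simp add: space_prob_algebra)
  have "\<bar>\<integral>\<eta>. f \<eta> \<partial>\<nu>\<bar> \<le> (\<integral>\<eta>. \<bar>f \<eta>\<bar> \<partial>\<nu>)" by (rule integral_abs_bound)
  also have "\<dots> \<le> (\<integral>\<eta>. c \<partial>\<nu>)"
    using le sets_eq_imp_space_eq[OF s] law_integrable[OF \<nu> f] by (intro integral_mono) auto
  finally show ?thesis by (simp add: prob_space)
qed

lemma LIMSEQ_if_subsequences:
  fixes a :: "nat \<Rightarrow> 'a::metric_space"
  assumes sub: "\<And>r :: nat \<Rightarrow> nat. strict_mono r \<Longrightarrow> \<exists>q :: nat \<Rightarrow> nat. strict_mono q \<and> (\<lambda>n. a (r (q n))) \<longlonglongrightarrow> l"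
  shows "a \<longlonglongrightarrow> l"
proof (rule ccontr)
  assume "\<not> a \<longlonglongrightarrow> l"
  then obtain e where e: "e > 0" and far: "\<forall>m. \<exists>n\<ge>m. \<not> dist (a n) l < e"
    by (auto simp: lim_sequentially)
  define S where "S = {n. \<not> dist (a n) l < e}"
  have inf: "infinite S" using far unfolding infinite_nat_iff_unbounded_le S_def by blast
  then obtain q where "(\<lambda>n. a (enumerate S (q n))) \<longlonglongrightarrow> l" using sub[OF strict_mono_enumerate[OF inf]] by blast
  then have "\<forall>\<^sub>F n in sequentially. dist (a (enumerate S (q n))) l < e" using e by (rule tendstoD)
  then obtain n where "dist (a (enumerate S (q n))) l < e" by (auto simp: eventually_sequentially)
  moreover have "enumerate S (q n) \<in> S" by (rule enumerate_in_set[OF inf])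
  ultimately show False by (simp add: S_def)
qed

text \<open>Coding configurations by points of a Cantor set in the line transfers Helly's selection theorem
  for real distributions to laws of spin configurations. In base \<open>3\<close> the code is injective: two
  digits that differ do so by \<open>2\<close>, whereas the digits after them can change the value by at most half
  of that. Vertices that \<open>from_nat\<close> repeats do not affect injectivity.\<close>

definition cantor_code :: "('v::countable \<Rightarrow> real) \<Rightarrow> real" where
  "cantor_code \<eta> = (\<Sum>n. \<eta> (from_nat n) * (1/3) ^ n)"

lemma summable_cantor_code:
  assumes "\<eta> \<in> configs" shows "summable (\<lambda>n. \<eta> (from_nat n) * (1/3) ^ n)"
proof (rule summable_comparison_test')
  show "summable (\<lambda>n. (1/3::real) ^ n)" by simp
  show "norm (\<eta> (from_nat n) * (1/3) ^ n) \<le> (1/3) ^ n" for n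
    using assms by (auto simp: configs_def abs_mult dest!: spec[of _ "from_nat n"])
qed

lemma continuous_cantor_code: "continuous_on configs (cantor_code :: ('v::countable \<Rightarrow> real) \<Rightarrow> real)"
proof -
  have "uniform_limit configs (\<lambda>n (\<eta> :: 'v \<Rightarrow> real). \<Sum>i<n. \<eta> (from_nat i) * (1/3) ^ i)
      (\<lambda>\<eta>. \<Sum>i. \<eta> (from_nat i) * (1/3) ^ i) sequentially"
  proof (rule Weierstrass_m_test)
    show "summable (\<lambda>n. (1/3::real) ^ n)" by simp
    show "norm (\<eta> (from_nat n) * (1/3) ^ n) \<le> (1/3) ^ n" if "\<eta> \<in> configs" for n and \<eta> :: "'v \<Rightarrow> real"
      using that by (auto simp: configs_def abs_mult dest!: spec[of _ "from_nat n"])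
  qed
  then show ?thesis
    unfolding cantor_code_def
    by (rule uniform_limit_theorem[rotated])
       (auto intro!: always_eventually continuous_intros continuous_on_subset[OF continuous_on_product_coordinates])
qed

lemma inj_cantor_code: "inj_on cantor_code (configs :: ('v::countable \<Rightarrow> real) set)"
proof (rule inj_onI, rule ccontr)
  fix \<eta> \<zeta> :: "'v \<Rightarrow> real"
  assume \<eta>: "\<eta> \<in> configs" and \<zeta>: "\<zeta> \<in> configs" and eq: "cantor_code \<eta> = cantor_code \<zeta>" and ne: "\<eta> \<noteq> \<zeta>"
  define d where "d n = (\<eta> (from_nat n) - \<zeta> (from_nat n))" for n
  from ne obtain x where "\<eta> x \<noteq> \<zeta> x" by blast
  then have ex: "\<exists>n. d n \<noteq> 0" by (auto simp: d_def intro!: exI[of _ "to_nat x"])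
  define m where "m = (LEAST n. d n \<noteq> 0)"
  have m: "d m \<noteq> 0" unfolding m_def by (rule LeastI_ex[OF ex])
  have small: "d n = 0" if "n < m" for n using not_less_Least[of n] that by (auto simp: m_def)
  have dvals: "d n \<in> {-2, 0, 2}" for n
    using \<eta> \<zeta> by (auto simp: d_def configs_def dest!: spec[of _ "from_nat n"])
  have "(\<lambda>n. \<eta> (from_nat n) * (1/3) ^ n - \<zeta> (from_nat n) * (1/3) ^ n) sums (cantor_code \<eta> - cantor_code \<zeta>)"
    unfolding cantor_code_def
    by (intro sums_diff summable_sums summable_cantor_code \<eta> \<zeta>)
  then have "(\<lambda>n. d n * (1/3) ^ n) sums 0"
    by (simp add: eq d_def left_diff_distrib)
  then have "(\<lambda>n. d (n + m) * (1/3) ^ (n + m)) sums 0"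
    using small by (subst sums_zero_iff_shift) auto
  then have "(\<lambda>n. d (n + m) * (1/3) ^ (n + m) * 3 ^ m) sums (0 * 3 ^ m)"
    by (rule sums_mult2)
  moreover have "d (n + m) * (1/3) ^ (n + m) * 3 ^ m = d (n + m) * (1/3) ^ n" for n
    by (simp add: power_add power_one_over)
  ultimately have "(\<lambda>n. d (n + m) * (1/3) ^ n) sums 0" by simp
  then have "(\<lambda>n. d (Suc n + m) * (1/3) ^ Suc n) sums (0 - d m)"
    by (subst sums_Suc_iff) simp
  moreover have "(\<lambda>n. 2 * ((1/3) * (1/3) ^ n)) sums (2 * ((1/3) * (1 / (1 - 1/3::real))))"
    by (intro sums_mult geometric_sums) simp
  then have one: "(\<lambda>n. 2 * ((1/3) ^ Suc n)) sums (1::real)" by simp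
  moreover have le: "\<bar>d (Suc n + m) * (1/3) ^ Suc n\<bar> \<le> 2 * ((1/3) ^ Suc n)" for n
    using dvals[of "Suc n + m"] by (auto simp: abs_mult)
  ultimately have "0 - d m \<le> 1" "-1 \<le> 0 - d m"
    using sums_le[of "\<lambda>n. d (Suc n + m) * (1/3) ^ Suc n" "\<lambda>n. 2 * ((1/3) ^ Suc n)" "0 - d m" 1]
      sums_le[OF _ sums_minus[OF one], of "\<lambda>n. d (Suc n + m) * (1/3) ^ Suc n" "0 - d m"]
    by (meson abs_le_iff minus_le_iff)+
  then show False using dvals[of m] m by auto
qed

text \<open>The image of the configurations under \<open>cantor_code\<close> is a compact set \<open>C\<close>, so the coded laws are
  tight and have a weakly convergent subsequence. Its limit is again carried by \<open>C\<close> and can be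
  decoded. A continuous function of the decoded configuration is continuous only on \<open>C\<close>; Tietze's
  theorem extends it to the line, where weak convergence applies.\<close>

lemma laws_sequentially_compact:
  fixes \<nu> :: "nat \<Rightarrow> ('v::countable \<Rightarrow> real) measure"
  assumes \<nu>: "\<And>n. \<nu> n \<in> space (prob_algebra config_space)"
  obtains r \<mu> where "strict_mono r" "\<mu> \<in> space (prob_algebra config_space)"
    "\<And>f :: ('v \<Rightarrow> real) \<Rightarrow> real. continuous_on configs f \<Longrightarrow>
       (\<lambda>n. \<integral>\<eta>. f \<eta> \<partial>\<nu> (r n)) \<longlonglongrightarrow> (\<integral>\<eta>. f \<eta> \<partial>\<mu>)"
proof -
  have prob: "prob_space (\<nu> n)" and sets: "sets (\<nu> n) = sets config_space" for n
    using \<nu>[of n] by (auto simp: space_prob_algebra)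
  have space: "space (\<nu> n) = configs" for n using sets_eq_imp_space_eq[OF sets[of n]] by simp
  have code [measurable]: "cantor_code \<in> \<nu> n \<rightarrow>\<^sub>M borel" for n
    using continuous_imp_config_measurable[OF continuous_cantor_code]
    by (simp add: measurable_cong_sets[OF sets refl])
  define C where "C = cantor_code ` (configs :: ('v \<Rightarrow> real) set)"
  have compact_C: "compact C"
    unfolding C_def by (rule compact_continuous_image[OF continuous_cantor_code compact_configs])
  then have closed_C: "closed C" by (rule compact_imp_closed)
  have C_ne: "C \<noteq> {}" using configs_nonempty by (simp add: C_def)
  define decode where "decode x = (if x \<in> C then inv_into configs cantor_code x else (\<lambda>_::'v. 1 :: real))"
    for x
  have decode_code: "decode (cantor_code \<eta>) = \<eta>" if "\<eta> \<in> configs" for \<eta> :: "'v \<Rightarrow> real"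
    using that by (simp add: decode_def C_def inv_into_f_f[OF inj_cantor_code])
  have cont_decode: "continuous_on C decode"
    unfolding C_def by (rule continuous_on_inv[OF continuous_cantor_code compact_configs])
       (use decode_code in blast)
  have decode_configs: "decode x \<in> configs" for x
    using decode_code by (cases "x \<in> C") (auto simp: C_def, auto simp: decode_def C_def configs_def)
  have "(\<lambda>x. if x \<in> C then decode x else (\<lambda>_. 1)) \<in> borel \<rightarrow>\<^sub>M (borel :: ('v \<Rightarrow> real) measure)"
    by (rule borel_measurable_continuous_on_if[OF _ cont_decode continuous_on_const])
       (use closed_C in auto)
  moreover have "(\<lambda>x. if x \<in> C then decode x else (\<lambda>_. 1)) = decode" by (auto simp: decode_def)
  ultimately have decode_meas [measurable]: "decode \<in> borel \<rightarrow>\<^sub>M config_space"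
    unfolding config_space_def by (intro measurable_restrict_space2) (auto simp: decode_configs)

  define P where "P n = distr (\<nu> n) borel cantor_code" for n
  have P: "real_distribution (P n)" for n
    unfolding P_def by (rule prob_space.real_distribution_distr[OF prob code])
  have P_int: "(\<integral>x. g x \<partial>P n) = (\<integral>\<eta>. g (cantor_code \<eta>) \<partial>\<nu> n)" if "g \<in> borel_measurable borel"
    for g :: "real \<Rightarrow> real" and n
    unfolding P_def by (rule integral_distr[OF code that])
  obtain B where B: "\<And>x. x \<in> C \<Longrightarrow> \<bar>x\<bar> \<le> B"
    using compact_imp_bounded[OF compact_C] by (auto simp: bounded_iff)
  have "measure (P n) {- (B + 1) <.. B + 1} = 1" for n
  proof -
    interpret prob_space "\<nu> n" by (rule prob)
    have "cantor_code -` {- (B + 1) <.. B + 1} \<inter> space (\<nu> n) = space (\<nu> n)"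
      using B by (force simp: space C_def)
    then show ?thesis by (simp add: P_def measure_distr prob_space)
  qed
  moreover have "B \<ge> 0" using B C_ne by force
  ultimately have "tight P"
    unfolding tight_def using P
    by (intro conjI allI impI exI[of _ "- (B + 1)"] exI[of _ "B + 1"]) simp_all
  from tight_imp_convergent_subsubsequence[OF this strict_mono_id]
  obtain r M where r: "strict_mono r" and M: "real_distribution M" and conv: "weak_conv_m (P \<circ> r) M"
    by auto
  interpret M: real_distribution M by (rule M)
  have lim: "(\<lambda>n. \<integral>\<eta>. g (cantor_code \<eta>) \<partial>\<nu> (r n)) \<longlonglongrightarrow> (\<integral>x. g x \<partial>M)"
    if cont: "continuous_on UNIV g" and bdd: "\<And>x. \<bar>g x\<bar> \<le> b" for g :: "real \<Rightarrow> real" and b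
  proof -
    have "(\<lambda>n. \<integral>x. g x \<partial>(P \<circ> r) n) \<longlonglongrightarrow> (\<integral>x. g x \<partial>M)"
      by (rule weak_conv_imp_integral_bdd_continuous_conv[OF _ M conv])
         (use P cont bdd in \<open>auto simp: continuous_on_eq_continuous_at\<close>)
    then show ?thesis by (simp add: P_int borel_measurable_continuous_onI[OF cont])
  qed
  \<comment> \<open>The truncated distance to \<open>C\<close> is bounded and continuous and has integral \<open>0\<close> along the sequence,
    hence also in the limit.\<close>
  have AE_C: "AE x in M. x \<in> C"
  proof -
    define g where "g x = min 1 (infdist x C)" for x
    have g: "continuous_on UNIV g" "\<And>x. \<bar>g x\<bar> \<le> 1" "\<And>x. g x \<ge> 0"
      unfolding g_def by (auto intro!: continuous_intros simp: infdist_nonneg)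
    have "(\<integral>\<eta>. g (cantor_code \<eta>) \<partial>\<nu> (r n)) = (\<integral>\<eta>. 0 \<partial>\<nu> (r n))" for n
      by (rule Bochner_Integration.integral_cong) (auto simp: space g_def C_def)
    then have "(\<integral>x. g x \<partial>M) = 0"
      using lim[OF g(1,2)] by (simp add: LIMSEQ_const_iff)
    moreover have "integrable M g"
      using borel_measurable_continuous_onI[OF g(1)] g(2)
      by (intro M.integrable_const_bound[of _ 1]) auto
    ultimately have "AE x in M. g x = 0"
      using integral_nonneg_eq_0_iff_AE[of M g] g(3) by auto
    then show ?thesis
      by eventually_elim (use in_closed_iff_infdist_zero[OF closed_C C_ne] in \<open>auto simp: g_def min_def split: if_splits\<close>)
  qed
  have dM: "decode \<in> M \<rightarrow>\<^sub>M config_space" by measurable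
  show thesis
  proof (rule that[OF r])
    show "distr M config_space decode \<in> space (prob_algebra config_space)"
      by (auto simp: space_prob_algebra intro!: M.prob_space_distr dM)
    fix f :: "('v \<Rightarrow> real) \<Rightarrow> real" assume f: "continuous_on configs f"
    obtain b where b: "b \<ge> 0" "\<And>\<eta>. \<eta> \<in> configs \<Longrightarrow> \<bar>f \<eta>\<bar> \<le> b" using continuous_configs_bounded[OF f] by blast
    have "continuous_on C (\<lambda>x. f (decode x))"
      by (rule continuous_on_compose2[OF f cont_decode]) (auto simp: decode_configs)
    from Tietze[of C "\<lambda>x. f (decode x)" UNIV b, OF this] closed_C b decode_configs
    obtain g where g: "continuous_on UNIV g" "\<And>x. x \<in> C \<Longrightarrow> g x = f (decode x)" "\<And>x. \<bar>g x\<bar> \<le> b"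
      by auto
    have "(\<integral>\<eta>. f \<eta> \<partial>distr M config_space decode) = (\<integral>x. f (decode x) \<partial>M)"
      by (rule integral_distr[OF dM continuous_imp_config_measurable[OF f]])
    also have "\<dots> = (\<integral>x. g x \<partial>M)"
      by (rule integral_cong_AE)
         (use AE_C g(2) borel_measurable_continuous_onI[OF g(1)]
            measurable_compose[OF dM continuous_imp_config_measurable[OF f]] in auto)
    finally have "(\<integral>\<eta>. f \<eta> \<partial>distr M config_space decode) = (\<integral>x. g x \<partial>M)" .
    moreover have "(\<integral>\<eta>. g (cantor_code \<eta>) \<partial>\<nu> (r n)) = (\<integral>\<eta>. f \<eta> \<partial>\<nu> (r n))" for n
      by (rule Bochner_Integration.integral_cong) (auto simp: space g(2) C_def decode_code)
    ultimately show "(\<lambda>n. \<integral>\<eta>. f \<eta> \<partial>\<nu> (r n)) \<longlonglongrightarrow> (\<integral>\<eta>. f \<eta> \<partial>distr M config_space decode)"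
      using lim[OF g(1,3)] by simp
  qed
qed

section \<open>Cylinder functions and the pregenerator\<close>

definition determined_by :: "'v set \<Rightarrow> (('v \<Rightarrow> real) \<Rightarrow> real) \<Rightarrow> bool" where
  "determined_by A f \<longleftrightarrow> (\<forall>\<eta>\<in>configs. \<forall>\<zeta>\<in>configs. (\<forall>x\<in>A. \<eta> x = \<zeta> x) \<longrightarrow> f \<eta> = f \<zeta>)"

lemma determined_byD:
  "determined_by A f \<Longrightarrow> \<eta> \<in> configs \<Longrightarrow> \<zeta> \<in> configs \<Longrightarrow> (\<And>x. x \<in> A \<Longrightarrow> \<eta> x = \<zeta> x) \<Longrightarrow> f \<eta> = f \<zeta>"
  unfolding determined_by_def by blast

lemma determined_by_mono: "determined_by A f \<Longrightarrow> A \<subseteq> B \<Longrightarrow> determined_by B f"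
  unfolding determined_by_def by blast

lemma determined_by_add:
  assumes f: "determined_by A f" and g: "determined_by B g"
    and h: "\<And>\<eta>. \<eta> \<in> configs \<Longrightarrow> h \<eta> = f \<eta> + g \<eta>"
  shows "determined_by (A \<union> B) h"
  unfolding determined_by_def
proof (intro ballI impI)
  fix \<eta> \<zeta> assume \<eta>: "\<eta> \<in> configs" and \<zeta>: "\<zeta> \<in> configs" and "\<forall>x\<in>A \<union> B. \<eta> x = \<zeta> x"
  then have "f \<eta> = f \<zeta>" "g \<eta> = g \<zeta>" by (auto intro: determined_byD[OF f] determined_byD[OF g])
  then show "h \<eta> = h \<zeta>" by (simp add: h \<eta> \<zeta>)
qed

lemma cylinder_iff_determined_by: "cylinder f \<longleftrightarrow> (\<exists>A. finite A \<and> determined_by A f)"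
  by (simp add: cylinder_def determined_by_def)

lemma flip_in_configs: "\<eta> \<in> configs \<Longrightarrow> flip \<eta> x \<in> configs"
  by (auto simp: flip_def configs_def)

text \<open>Indicators of events that concern finitely many spins are cylinder functions, and these events
  generate the sigma-algebra. Uniqueness is known for infinite products, so both laws are regarded as
  laws on all real-valued functions on the vertices.\<close>

lemma laws_eqI:
  fixes \<mu> \<nu> :: "('v::countable \<Rightarrow> real) measure"
  assumes \<mu>: "\<mu> \<in> space (prob_algebra config_space)" and \<nu>: "\<nu> \<in> space (prob_algebra config_space)"
    and eq: "\<And>f. cylinder f \<Longrightarrow> (\<And>\<eta>. \<bar>f \<eta>\<bar> \<le> 1) \<Longrightarrow> (\<integral>\<eta>. f \<eta> \<partial>\<mu>) = (\<integral>\<eta>. f \<eta> \<partial>\<nu>)"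
  shows "\<mu> = \<nu>"
proof -
  have closed: "closed (configs :: ('v \<Rightarrow> real) set)" by (rule compact_imp_closed[OF compact_configs])
  have prob: "prob_space M" and sets: "sets M = sets config_space" and space: "space M = configs"
    and incl: "(\<lambda>\<eta>. \<eta>) \<in> M \<rightarrow>\<^sub>M borel"
    if M: "M \<in> space (prob_algebra config_space)" for M :: "('v \<Rightarrow> real) measure"
  proof -
    show "prob_space M" and s: "sets M = sets config_space" using M by (auto simp: space_prob_algebra)
    show "space M = configs" using sets_eq_imp_space_eq[OF s] by simp
    show "(\<lambda>\<eta>. \<eta>) \<in> M \<rightarrow>\<^sub>M borel"
      using continuous_on_id[of configs] unfolding measurable_cong_sets[OF s refl] config_space_def
      by (intro borel_measurable_continuous_on_restrict)
  qed
  have box: "emeasure \<mu> ({\<eta>. \<forall>j\<in>J. \<eta> j \<in> A j} \<inter> configs) = emeasure \<nu> ({\<eta>. \<forall>j\<in>J. \<eta> j \<in> A j} \<inter> configs)"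
    if J: "finite J" and A: "\<And>j. j \<in> J \<Longrightarrow> A j \<in> sets borel" for A :: "'v \<Rightarrow> real set" and J
  proof -
    define f where "f = (\<lambda>\<eta>. indicator {\<eta>. \<forall>j\<in>J. \<eta> j \<in> A j} \<eta> :: real)"
    have "determined_by J f" by (auto simp: determined_by_def f_def indicator_def)
    then have "cylinder f" using J by (auto simp: cylinder_iff_determined_by)
    moreover have "\<bar>f \<eta>\<bar> \<le> 1" for \<eta> by (auto simp: f_def indicator_def)
    ultimately have "(\<integral>\<eta>. f \<eta> \<partial>\<mu>) = (\<integral>\<eta>. f \<eta> \<partial>\<nu>)" by (rule eq)
    moreover have "(\<integral>\<eta>. f \<eta> \<partial>M) = measure M ({\<eta>. \<forall>j\<in>J. \<eta> j \<in> A j} \<inter> configs)"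
      if M: "M \<in> space (prob_algebra config_space)" for M :: "('v \<Rightarrow> real) measure"
      unfolding f_def by (simp add: space[OF M])
    ultimately show ?thesis
      using \<mu> \<nu> prob
      by (simp add: finite_measure.emeasure_eq_measure prob_space.finite_measure)
  qed
  have "distr \<mu> borel (\<lambda>\<eta>. \<eta>) = distr \<nu> borel (\<lambda>\<eta>. \<eta>)"
  proof (rule measure_eqI_PiM_infinite[where I = UNIV and M = "\<lambda>_::'v. borel :: real measure"])
    show "finite_measure (distr \<mu> borel (\<lambda>\<eta>. \<eta>))"
      by (intro prob_space.finite_measure prob_space.prob_space_distr prob incl \<mu>)
    fix A :: "'v \<Rightarrow> real set" and J :: "'v set"
    assume J: "finite J" and A: "\<And>j. j \<in> J \<Longrightarrow> A j \<in> sets (borel :: real measure)"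
    have emb: "prod_emb UNIV (\<lambda>_::'v. borel :: real measure) J (Pi\<^sub>E J A) = {\<eta>. \<forall>j\<in>J. \<eta> j \<in> A j}"
      by (auto simp: prod_emb_def restrict_PiE_iff)
    have "prod_emb UNIV (\<lambda>_::'v. borel :: real measure) J (Pi\<^sub>E J A) \<in> sets (Pi\<^sub>M UNIV (\<lambda>_::'v. borel))"
      using J A by (intro sets_PiM_I) auto
    then have "{\<eta>. \<forall>j\<in>J. \<eta> j \<in> A j} \<in> sets (borel :: ('v \<Rightarrow> real) measure)"
      unfolding emb sets_PiM_equal_borel .
    then show "emeasure (distr \<mu> borel (\<lambda>\<eta>. \<eta>)) (prod_emb UNIV (\<lambda>_. borel) J (Pi\<^sub>E J A)) =
        emeasure (distr \<nu> borel (\<lambda>\<eta>. \<eta>)) (prod_emb UNIV (\<lambda>_. borel) J (Pi\<^sub>E J A))"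
      unfolding emb using box[OF J A]
      by (simp add: emeasure_distr incl[OF \<mu>] incl[OF \<nu>] space[OF \<mu>] space[OF \<nu>])
  qed (simp_all add: sets_PiM_equal_borel)
  then have distr_eq: "emeasure (distr \<mu> borel (\<lambda>\<eta>. \<eta>)) X = emeasure (distr \<nu> borel (\<lambda>\<eta>. \<eta>)) X" for X
    by simp
  show ?thesis
  proof (rule measure_eqI)
    show "sets \<mu> = sets \<nu>" by (simp add: sets \<mu> \<nu>)
    fix X assume "X \<in> sets \<mu>"
    then have X: "X \<in> sets borel" "X \<subseteq> configs"
      using closed by (auto simp: sets[OF \<mu>] config_space_def sets_restrict_space)
    then show "emeasure \<mu> X = emeasure \<nu> X"
      using distr_eq[of X]
      by (simp add: emeasure_distr incl[OF \<mu>] incl[OF \<nu>] space[OF \<mu>] space[OF \<nu>] Int_absorb2)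
  qed
qed

section \<open>Duality: functions of few spins\<close>

definition copy_spin :: "('v set \<Rightarrow> real) \<Rightarrow> 'v \<Rightarrow> 'v \<Rightarrow> ('v \<Rightarrow> real) \<Rightarrow> 'v \<Rightarrow> real" where
  "copy_spin s x y \<eta> = \<eta>(x := s {x, y} * \<eta> y)"

text \<open>A size of functions that the dual dynamics does not increase, like the total mass of a signed
  measure on the states of the dual process. The sup norm would not serve: that \<open>1 + \<Omega> / N\<close> is an average
  can be seen only from a decomposition of \<open>f\<close> into functions of at most \<open>n\<close> spins, and \<open>c\<close> adds up the
  bounds on these summands. The number of spins on which the whole sum depends is unrestricted, as it
  grows under iteration. Values outside the configurations are ignored, as they are meaningless.\<close>

inductive few_spins :: "nat \<Rightarrow> real \<Rightarrow> (('v \<Rightarrow> real) \<Rightarrow> real) \<Rightarrow> bool" for n where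
  base: "finite A \<Longrightarrow> card A \<le> n \<Longrightarrow> determined_by A f \<Longrightarrow> (\<And>\<eta>. \<eta> \<in> configs \<Longrightarrow> \<bar>f \<eta>\<bar> \<le> c) \<Longrightarrow>
    few_spins n c f"
| add: "few_spins n c f \<Longrightarrow> few_spins n d g \<Longrightarrow> (\<And>\<eta>. \<eta> \<in> configs \<Longrightarrow> h \<eta> = f \<eta> + g \<eta>) \<Longrightarrow>
    few_spins n (c + d) h"

lemma few_spins_bound: "few_spins n c f \<Longrightarrow> \<eta> \<in> configs \<Longrightarrow> \<bar>f \<eta>\<bar> \<le> c"
proof (induction rule: few_spins.induct)
  case (add c f d g h)
  then have "\<bar>f \<eta>\<bar> \<le> c" "\<bar>g \<eta>\<bar> \<le> d" "h \<eta> = f \<eta> + g \<eta>" by blast+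
  then show ?case by linarith
qed blast

lemma few_spins_cylinder: "few_spins n c f \<Longrightarrow> cylinder f"
proof (induction rule: few_spins.induct)
  case (base A f c)
  then show ?case by (auto simp: cylinder_iff_determined_by)
next
  case (add c f d g h)
  then obtain A B where "finite A" "determined_by A f" "finite B" "determined_by B g"
    by (auto simp: cylinder_iff_determined_by)
  then have "finite (A \<union> B)" "determined_by (A \<union> B) h"
    using determined_by_add[of A f B g h] add.hyps(3) by auto
  then show ?case unfolding cylinder_iff_determined_by by blast
qed

lemma few_spins_scale: "few_spins n c f \<Longrightarrow> r \<ge> 0 \<Longrightarrow> few_spins n (r * c) (\<lambda>\<eta>. r * f \<eta>)"
proof (induction rule: few_spins.induct)
  case (base A f c)
  show ?case
  proof (rule few_spins.base[OF base.hyps(1,2)])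
    show "determined_by A (\<lambda>\<eta>. r * f \<eta>)"
      using base.hyps(3) unfolding determined_by_def by metis
    show "\<bar>r * f \<eta>\<bar> \<le> r * c" if "\<eta> \<in> configs" for \<eta>
      using base.hyps(4)[OF that] base.prems by (simp add: abs_mult mult_left_mono)
  qed
next
  case (add c f d g h)
  then show ?case
    using few_spins.add[of n "r * c" "\<lambda>\<eta>. r * f \<eta>" "r * d" "\<lambda>\<eta>. r * g \<eta>" "\<lambda>\<eta>. r * h \<eta>"]
    by (simp add: distrib_left)
qed

lemma few_spins_sum:
  assumes "finite I" "\<And>i. i \<in> I \<Longrightarrow> few_spins n (c i) (f i)"
  shows "few_spins n (\<Sum>i\<in>I. c i) (\<lambda>\<eta>. \<Sum>i\<in>I. f i \<eta>)"
  using assms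
proof (induction I rule: finite_induct)
  case empty
  show ?case by (rule few_spins.base[of "{}"]) (auto simp: determined_by_def)
next
  case (insert i I)
  have "few_spins n (c i + (\<Sum>i\<in>I. c i)) (\<lambda>\<eta>. \<Sum>i\<in>insert i I. f i \<eta>)"
    by (rule few_spins.add[of n "c i" "f i" "\<Sum>i\<in>I. c i" "\<lambda>\<eta>. \<Sum>i\<in>I. f i \<eta>"]) (use insert in auto)
  then show ?case using insert by simp
qed

lemma pregenerator_finite_sum:
  assumes A: "finite A" "determined_by A f" and \<eta>: "\<eta> \<in> configs"
  shows "pregenerator E s f \<eta> = (\<Sum>x\<in>A. (f (flip \<eta> x) - f \<eta>) * flip_rate E s x \<eta>)"
proof -
  have "f (flip \<eta> x) = f \<eta>" if "x \<notin> A" for x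
    by (rule determined_byD[OF A(2) flip_in_configs[OF \<eta>] \<eta>]) (use that in \<open>auto simp: flip_def\<close>)
  then have "pregenerator E s f \<eta> = (\<Sum>\<^sub>\<infinity>x\<in>A. (f (flip \<eta> x) - f \<eta>) * flip_rate E s x \<eta>)"
    unfolding pregenerator_def by (intro infsum_cong_neutral) auto
  then show ?thesis using A(1) by simp
qed

lemma pregenerator_add:
  assumes f: "cylinder f" and g: "cylinder g" and h: "\<And>\<eta>. \<eta> \<in> configs \<Longrightarrow> h \<eta> = f \<eta> + g \<eta>"
    and \<eta>: "\<eta> \<in> configs"
  shows "pregenerator E s h \<eta> = pregenerator E s f \<eta> + pregenerator E s g \<eta>"
proof -
  obtain A B where A: "finite A" "determined_by A f" and B: "finite B" "determined_by B g"
    using f g by (auto simp: cylinder_iff_determined_by)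
  let ?C = "A \<union> B"
  have fin: "finite ?C" using A B by simp
  have f': "determined_by ?C f" and g': "determined_by ?C g"
    using determined_by_mono[OF A(2), of ?C] determined_by_mono[OF B(2), of ?C] by auto
  have h': "determined_by ?C h" by (rule determined_by_add[OF A(2) B(2) h])
  show ?thesis
    unfolding pregenerator_finite_sum[OF fin f' \<eta>] pregenerator_finite_sum[OF fin g' \<eta>]
      pregenerator_finite_sum[OF fin h' \<eta>]
    by (simp add: h \<eta> flip_in_configs distrib_right left_diff_distrib sum.distrib sum_subtractf)
qed

locale signed_graph =
  fixes E :: "'v set set" and s :: "'v set \<Rightarrow> real"
  assumes graph: "locally_finite_graph E" and signs: "sign_function E s"
begin

lemma finite_neighbours: "finite (neighbours E x)"
  using graph by (simp add: locally_finite_graph_def)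

lemma degree_pos: "vertex_degree E x > 0"
  using graph unfolding locally_finite_graph_def by (metis One_nat_def Suc_le_lessD)

lemma copy_spin_in_configs:
  assumes "\<eta> \<in> configs" "y \<in> neighbours E x" shows "copy_spin s x y \<eta> \<in> configs"
proof -
  have "s {x, y} \<in> {-1, 1}" "\<eta> y \<in> {-1, 1}"
    using assms signs by (auto simp: neighbours_def sign_function_def configs_def)
  then show ?thesis using assms(1) by (auto simp: copy_spin_def configs_def)
qed

text \<open>The flip rate counts exactly those neighbours \<open>y\<close> for which copying from \<open>y\<close> reverses the spin at
  \<open>x\<close>; copying from any other neighbour leaves the configuration as it is.\<close>

lemma pregenerator_copy_spin:
  assumes A: "finite A" "determined_by A f" and \<eta>: "\<eta> \<in> configs"
  shows "pregenerator E s f \<eta> =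
    (\<Sum>x\<in>A. \<Sum>y\<in>neighbours E x. (f (copy_spin s x y \<eta>) - f \<eta>) / real (vertex_degree E x))"
proof -
  have "(f (flip \<eta> x) - f \<eta>) * of_bool (\<eta> x * \<eta> y \<noteq> s {x, y}) = f (copy_spin s x y \<eta>) - f \<eta>"
    if "y \<in> neighbours E x" for x y
  proof -
    have s: "s {x, y} \<in> {-1, 1}"
      using that signs by (auto simp: neighbours_def sign_function_def)
    have \<eta>x: "\<eta> x \<in> {-1, 1}" and \<eta>y: "\<eta> y \<in> {-1, 1}" using \<eta> by (auto simp: configs_def)
    show ?thesis
    proof (cases "\<eta> x * \<eta> y = s {x, y}")
      case True
      then have "s {x, y} * \<eta> y = \<eta> x" using \<eta>y by auto
      then have "copy_spin s x y \<eta> = \<eta>" by (simp add: copy_spin_def)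
      then show ?thesis using True by simp
    next
      case False
      then have "s {x, y} * \<eta> y = - \<eta> x" using s \<eta>x \<eta>y by auto
      then have "copy_spin s x y \<eta> = flip \<eta> x" by (simp add: copy_spin_def flip_def)
      then show ?thesis using False by simp
    qed
  qed
  then have "(f (flip \<eta> x) - f \<eta>) * flip_rate E s x \<eta> =
      (\<Sum>y\<in>neighbours E x. (f (copy_spin s x y \<eta>) - f \<eta>) / real (vertex_degree E x))" for x
    unfolding flip_rate_def
    by (simp add: sum_distrib_left sum_divide_distrib[symmetric] cong: sum.cong)
  then show ?thesis by (simp add: pregenerator_finite_sum[OF A \<eta>])
qed

text \<open>The step of a dual walk: a particle at \<open>x\<close> jumps to \<open>y\<close> and coalesces with a particle that is
  already there.\<close>

lemma determined_by_copy_spin: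
  assumes f: "determined_by A f" and y: "y \<in> neighbours E x"
  shows "determined_by (insert y (A - {x})) (\<lambda>\<eta>. f (copy_spin s x y \<eta>))"
  unfolding determined_by_def
proof (intro ballI impI)
  fix \<eta> \<zeta> assume "\<eta> \<in> configs" "\<zeta> \<in> configs" and eq: "\<forall>z\<in>insert y (A - {x}). \<eta> z = \<zeta> z"
  then show "f (copy_spin s x y \<eta>) = f (copy_spin s x y \<zeta>)"
    by (intro determined_byD[OF f] copy_spin_in_configs y) (auto simp: copy_spin_def)
qed

text \<open>For a function \<open>f\<close> of the spins in \<open>A\<close>, the new function is the average of \<open>f\<close> itself, with weight
  \<open>1 - card A / N\<close>, and of the functions \<open>f \<circ> copy_spin s x y\<close> with \<open>x \<in> A\<close> and \<open>y\<close> a neighbour of \<open>x\<close>, with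
  weights \<open>1 / (N d(x))\<close>. The weights are nonnegative because \<open>card A \<le> n \<le> N\<close>, and they sum to \<open>1\<close>.
  Sums of such functions are covered by linearity.\<close>

lemma few_spins_uniformised_step:
  assumes f: "few_spins n c f" and N: "N > 0" "real n \<le> N"
  shows "few_spins n c (\<lambda>\<eta>. f \<eta> + pregenerator E s f \<eta> / N)"
  using f
proof (induction rule: few_spins.induct)
  case (base A f c)
  let ?d = "\<lambda>x. real (vertex_degree E x)" and ?m = "1 - real (card A) / N"
  have d: "?d x > 0" for x using degree_pos by simp
  have m: "?m \<ge> 0" using N base.hyps(2) by (simp add: field_simps)
  have deg: "(\<Sum>y\<in>neighbours E x. r / (N * ?d x)) = r / N" for x and r :: real
    using d[of x] by (simp add: vertex_degree_def)
  have copy: "few_spins n c (\<lambda>\<eta>. f (copy_spin s x y \<eta>))" if x: "x \<in> A" and y: "y \<in> neighbours E x" for x y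
  proof (rule few_spins.base)
    show "finite (insert y (A - {x}))" using base.hyps(1) by simp
    have "card (insert y (A - {x})) \<le> Suc (card (A - {x}))" using base.hyps(1) by (simp add: card_insert_le_m1 card_insert_if)
    also have "\<dots> = card A" using base.hyps(1) x by (metis card.remove)
    finally show "card (insert y (A - {x})) \<le> n" using base.hyps(2) by simp
    show "determined_by (insert y (A - {x})) (\<lambda>\<eta>. f (copy_spin s x y \<eta>))"
      by (rule determined_by_copy_spin[OF base.hyps(3) y])
  qed (use base.hyps(4) copy_spin_in_configs y in auto)
  have "few_spins n (?m * c + (\<Sum>x\<in>A. \<Sum>y\<in>neighbours E x. 1 / (N * ?d x) * c))
      (\<lambda>\<eta>. f \<eta> + pregenerator E s f \<eta> / N)"
  proof (rule few_spins.add)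
    show "few_spins n (?m * c) (\<lambda>\<eta>. ?m * f \<eta>)"
      using base.hyps m by (intro few_spins_scale few_spins.base[of A]) auto
    show "few_spins n (\<Sum>x\<in>A. \<Sum>y\<in>neighbours E x. 1 / (N * ?d x) * c)
        (\<lambda>\<eta>. \<Sum>x\<in>A. \<Sum>y\<in>neighbours E x. 1 / (N * ?d x) * f (copy_spin s x y \<eta>))"
      using N by (intro few_spins_sum base.hyps finite_neighbours few_spins_scale copy) auto
    fix \<eta> :: "'v \<Rightarrow> real" assume \<eta>: "\<eta> \<in> configs"
    have "pregenerator E s f \<eta> / N =
        (\<Sum>x\<in>A. \<Sum>y\<in>neighbours E x. 1 / (N * ?d x) * f (copy_spin s x y \<eta>) - f \<eta> / (N * ?d x))"
      unfolding pregenerator_copy_spin[OF base.hyps(1,3) \<eta>]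
      by (simp add: sum_divide_distrib diff_divide_distrib mult.commute)
    also have "\<dots> = (\<Sum>x\<in>A. \<Sum>y\<in>neighbours E x. 1 / (N * ?d x) * f (copy_spin s x y \<eta>))
        - real (card A) * (f \<eta> / N)"
      by (simp only: sum_subtractf deg) simp
    finally show "f \<eta> + pregenerator E s f \<eta> / N = ?m * f \<eta> +
        (\<Sum>x\<in>A. \<Sum>y\<in>neighbours E x. 1 / (N * ?d x) * f (copy_spin s x y \<eta>))"
      by (simp add: algebra_simps)
  qed
  moreover have "?m * c + (\<Sum>x\<in>A. \<Sum>y\<in>neighbours E x. 1 / (N * ?d x) * c) = c"
    using deg[of c] by (simp add: algebra_simps)
  ultimately show ?case by simp
next
  case (add c f d g h)
  have "pregenerator E s h \<eta> = pregenerator E s f \<eta> + pregenerator E s g \<eta>" if "\<eta> \<in> configs" for \<eta>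
    by (rule pregenerator_add) (use add.hyps few_spins_cylinder that in auto)
  then show ?case
    by (intro few_spins.add[OF add.IH]) (auto simp: add.hyps(3) add_divide_distrib)
qed

end

section \<open>The semigroup of the signed voter model\<close>

locale signed_voter_process = signed_graph E s
  for E :: "('v::countable) set set" and s :: "'v set \<Rightarrow> real" +
  fixes K :: "'v transition"
  assumes model: "signed_voter_model E s K"
begin

lemma kernel: "t \<ge> 0 \<Longrightarrow> K t \<in> config_space \<rightarrow>\<^sub>M prob_algebra config_space"
  using model by (simp add: signed_voter_model_def feller_process_def)

lemma kernel_law: "t \<ge> 0 \<Longrightarrow> \<eta> \<in> configs \<Longrightarrow> K t \<eta> \<in> space (prob_algebra config_space)"
  using measurable_space[OF kernel] by simp

lemma transition_op_continuous:
  "continuous_on configs f \<Longrightarrow> t \<ge> 0 \<Longrightarrow> continuous_on configs (transition_op K t f)"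
  using model by (simp add: signed_voter_model_def feller_process_def)

lemma integral_bind_kernel:
  assumes \<nu>: "\<nu> \<in> space (prob_algebra config_space)" and f: "continuous_on configs f" and u: "u \<ge> 0"
  shows "(\<integral>\<zeta>. f \<zeta> \<partial>(\<nu> \<bind> K u)) = (\<integral>\<eta>. transition_op K u f \<eta> \<partial>\<nu>)"
proof -
  have s: "sets \<nu> = sets config_space" and prob: "prob_space \<nu>" using \<nu> by (auto simp: space_prob_algebra)
  obtain B where B: "\<And>\<eta>. \<eta> \<in> configs \<Longrightarrow> \<bar>f \<eta>\<bar> \<le> B" using continuous_configs_bounded[OF f] by blast
  show ?thesis unfolding transition_op_def
  proof (rule integral_bind)
    show "f \<in> borel_measurable config_space" by (rule continuous_imp_config_measurable[OF f])
    show "\<bar>f \<eta>\<bar> \<le> B" if "\<eta> \<in> space config_space" for \<eta> using B that by simp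
    show "K u \<in> \<nu> \<rightarrow>\<^sub>M subprob_algebra config_space"
      using measurable_prob_algebraD[OF kernel[OF u]] by (simp add: measurable_cong_sets[OF s refl])
    show "finite_measure \<nu>" by (rule prob_space.finite_measure[OF prob])
    show "AE \<eta> in \<nu>. emeasure (K u \<eta>) (space (K u \<eta>)) \<le> ennreal 1"
    proof (rule AE_I2)
      fix \<eta> assume "\<eta> \<in> space \<nu>"
      then have "K u \<eta> \<in> space (prob_algebra config_space)"
        using kernel_law[OF u] sets_eq_imp_space_eq[OF s] by simp
      then show "emeasure (K u \<eta>) (space (K u \<eta>)) \<le> ennreal 1"
        by (simp add: space_prob_algebra prob_space.emeasure_space_1)
    qed
  qed
qed

lemma transition_op_add:
  assumes "continuous_on configs f" "t \<ge> 0" "u \<ge> 0" "\<eta> \<in> configs"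
  shows "transition_op K (t + u) f \<eta> = transition_op K t (transition_op K u f) \<eta>"
proof -
  have "K (t + u) \<eta> = K t \<eta> \<bind> K u"
    using model assms by (simp add: signed_voter_model_def feller_process_def)
  then show ?thesis
    using integral_bind_kernel[OF kernel_law assms(1), of t \<eta> u] assms
    by (simp add: transition_op_def[abs_def])
qed

lemma transition_op_diff:
  assumes "continuous_on configs f" "continuous_on configs g" "t \<ge> 0" "\<eta> \<in> configs"
  shows "transition_op K t (\<lambda>\<zeta>. f \<zeta> - g \<zeta>) \<eta> = transition_op K t f \<eta> - transition_op K t g \<eta>"
  unfolding transition_op_def
  by (intro Bochner_Integration.integral_diff law_integrable[OF kernel_law] assms)

lemma transition_op_scale: "transition_op K t (\<lambda>\<zeta>. r * f \<zeta>) \<eta> = r * transition_op K t f \<eta>"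
  by (simp add: transition_op_def)

lemma transition_op_bound:
  assumes "continuous_on configs f" "t \<ge> 0" "\<eta> \<in> configs" "\<And>\<zeta>. \<zeta> \<in> configs \<Longrightarrow> \<bar>f \<zeta>\<bar> \<le> c"
  shows "\<bar>transition_op K t f \<eta>\<bar> \<le> c"
  unfolding transition_op_def by (rule law_integral_le[OF kernel_law]) (use assms in auto)

text \<open>The generator gives the right derivative at time \<open>0\<close>, uniformly on configurations. The semigroup
  property and contractivity carry it to positive times. For the left derivative the time \<open>t\<close> is
  reached from \<open>t - k\<close>, and the difference between \<open>U\<^sub>t\<^sub>-\<^sub>k g\<close> and \<open>U\<^sub>t g\<close> is absorbed by strong
  continuity.\<close>

lemma transition_op_has_derivative:
  assumes gen: "in_generator K f g" and t: "t > 0" and \<eta>: "\<eta> \<in> configs"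
  shows "((\<lambda>t. transition_op K t f \<eta>) has_real_derivative transition_op K t g \<eta>) (at t)"
proof -
  let ?U = "transition_op K"
  define q where "q h \<zeta> = (?U h f \<zeta> - f \<zeta>) / h" for h \<zeta>
  have f: "continuous_on configs f" and g: "continuous_on configs g"
    and lim_q: "uniform_limit configs q g (at_right 0)"
    using gen by (auto simp: in_generator_def q_def[abs_def])
  have lim_g: "uniform_limit configs (\<lambda>h. ?U h g) g (at_right 0)"
    using model g by (simp add: signed_voter_model_def feller_process_def)
  have q: "continuous_on configs (q h)" if "h > 0" for h
    unfolding q_def by (intro continuous_intros transition_op_continuous f) (use that in auto)
  have U_q: "?U u (q h) \<eta> = (?U (u + h) f \<eta> - ?U u f \<eta>) / h" if "u \<ge> 0" "h > 0" for u h
  proof -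
    have "q h = (\<lambda>\<zeta>. (1 / h) * (?U h f \<zeta> - f \<zeta>))" by (auto simp: q_def)
    then have "?U u (q h) \<eta> = (1 / h) * (?U u (?U h f) \<eta> - ?U u f \<eta>)"
      by (simp only: transition_op_scale)
         (simp add: transition_op_diff transition_op_continuous f that \<eta> less_imp_le)
    then show ?thesis using that by (simp add: transition_op_add f \<eta>)
  qed
  have near_q: "\<forall>\<^sub>F h in at_right 0. \<forall>\<zeta>\<in>configs. \<bar>q h \<zeta> - g \<zeta>\<bar> < e"
    and near_g: "\<forall>\<^sub>F h in at_right 0. \<forall>\<zeta>\<in>configs. \<bar>?U h g \<zeta> - g \<zeta>\<bar> < e" if "e > 0" for e
    using uniform_limitD[OF lim_q that] uniform_limitD[OF lim_g that] by (auto simp: dist_real_def)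
  have pos: "\<forall>\<^sub>F h in at_right 0. h > (0::real)" by (simp add: eventually_at_right_less)
  have right: "((\<lambda>h. (?U (t + h) f \<eta> - ?U t f \<eta>) / h) \<longlongrightarrow> ?U t g \<eta>) (at_right 0)"
  proof (rule tendstoI)
    fix e :: real assume "e > 0"
    then have "e / 2 > 0" by simp
    from near_q[OF this] pos
    have "\<forall>\<^sub>F h in at_right 0. (\<forall>\<zeta>\<in>configs. \<bar>q h \<zeta> - g \<zeta>\<bar> < e / 2) \<and> h > 0" by eventually_elim auto
    then show "\<forall>\<^sub>F h in at_right 0. dist ((?U (t + h) f \<eta> - ?U t f \<eta>) / h) (?U t g \<eta>) < e"
    proof eventually_elim
      case (elim h)
      have "\<bar>?U t (\<lambda>\<zeta>. q h \<zeta> - g \<zeta>) \<eta>\<bar> \<le> e / 2"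
        by (rule transition_op_bound) (use elim t \<eta> in \<open>auto intro!: continuous_intros q g less_imp_le\<close>)
      then show ?case
        using elim t \<eta> \<open>e > 0\<close> by (simp add: transition_op_diff q g U_q dist_real_def)
    qed
  qed
  have "((\<lambda>k. (?U (t - k) f \<eta> - ?U t f \<eta>) / (- k)) \<longlongrightarrow> ?U t g \<eta>) (at_right 0)"
  proof (rule tendstoI)
    fix e :: real assume "e > 0"
    have "\<forall>\<^sub>F k in at_right 0. k < t" using t by (simp add: eventually_at_right_field) blast
    moreover from \<open>e > 0\<close> have "e / 3 > 0" by simp
    note near_q[OF this] near_g[OF this] pos
    ultimately have "\<forall>\<^sub>F k in at_right 0. (\<forall>\<zeta>\<in>configs. \<bar>q k \<zeta> - ?U k g \<zeta>\<bar> \<le> 2 * e / 3) \<and> k > 0 \<and> k < t"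
    proof eventually_elim
      case (elim k)
      have "\<bar>q k \<zeta> - ?U k g \<zeta>\<bar> \<le> 2 * e / 3" if "\<zeta> \<in> configs" for \<zeta>
        using elim(2,3)[rule_format, OF that] by linarith
      then show ?case using elim by blast
    qed
    then show "\<forall>\<^sub>F k in at_right 0. dist ((?U (t - k) f \<eta> - ?U t f \<eta>) / (- k)) (?U t g \<eta>) < e"
    proof eventually_elim
      case (elim k)
      have "\<bar>?U (t - k) (\<lambda>\<zeta>. q k \<zeta> - ?U k g \<zeta>) \<eta>\<bar> \<le> 2 * e / 3"
        by (rule transition_op_bound)
           (use elim \<eta> in \<open>auto intro!: continuous_intros q transition_op_continuous g\<close>)
      moreover have "?U (t - k) (\<lambda>\<zeta>. q k \<zeta> - ?U k g \<zeta>) \<eta> = ?U (t - k) (q k) \<eta> - ?U (t - k) (?U k g) \<eta>"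
        by (rule transition_op_diff) (use elim \<eta> in \<open>auto intro!: q transition_op_continuous g\<close>)
      moreover have "?U (t - k) (?U k g) \<eta> = ?U t g \<eta>"
        using transition_op_add[OF g, of "t - k" k \<eta>] elim \<eta> by simp
      moreover have "?U (t - k) (q k) \<eta> = (?U (t - k) f \<eta> - ?U t f \<eta>) / (- k)"
        using U_q[of "t - k" k] elim by (simp add: field_simps)
      ultimately show ?case using \<open>e > 0\<close> by (simp add: dist_real_def)
    qed
  qed
  then have left: "((\<lambda>h. (?U (t + h) f \<eta> - ?U t f \<eta>) / h) \<longlongrightarrow> ?U t g \<eta>) (at_left 0)"
    by (subst filterlim_at_left_to_right) simp
  show ?thesis
    unfolding DERIV_def using left right by (simp add: filterlim_at_split)
qed

lemma cylinder_in_generator: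
  assumes "cylinder f" shows "in_generator K f (pregenerator E s f)"
proof -
  have "in_pregenerator_closure E s f (pregenerator E s f)"
    unfolding in_pregenerator_closure_def
    by (rule exI[of _ "\<lambda>_. f"]) (use assms in \<open>auto intro!: uniform_limit_const\<close>)
  then show ?thesis using model by (simp add: signed_voter_model_def)
qed

lemma cylinder_continuous:
  fixes f :: "('v \<Rightarrow> real) \<Rightarrow> real"
  shows "cylinder f \<Longrightarrow> continuous_on configs f"
  using cylinder_in_generator[of f] by (simp add: in_generator_def)

text \<open>The iterates of \<open>1 + \<Omega> / N\<close> on \<open>f\<close> stay bounded by \<open>c\<close>, and the pregenerator maps each of them to \<open>N\<close>
  times the difference to the next one. Their expectations at time \<open>t\<close> therefore form a system to
  which \<open>poissonised_sequence_asymptotically_constant\<close> applies.\<close>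

lemma transition_op_asymptotically_constant:
  assumes f: "cylinder f" "\<And>\<zeta>. \<zeta> \<in> configs \<Longrightarrow> \<bar>f \<zeta>\<bar> \<le> c" and h: "h \<ge> 0" and \<eta>: "\<eta> \<in> configs"
  shows "((\<lambda>t. transition_op K (t + h) f \<eta> - transition_op K t f \<eta>) \<longlongrightarrow> 0) at_top"
proof -
  obtain A where A: "finite A" "determined_by A f" using f(1) by (auto simp: cylinder_iff_determined_by)
  \<comment> \<open>The successor keeps \<open>N\<close> positive when \<open>A\<close> is empty.\<close>
  define n where "n = Suc (card A)"
  define N where "N = real n"
  have N: "N > 0" "real n \<le> N" by (auto simp: N_def n_def)
  define step where "step = (\<lambda>g \<zeta>. g \<zeta> + pregenerator E s g \<zeta> / N)"
  define g where "g k = (step ^^ k) f" for k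
  have few: "few_spins n c (g k)" for k
  proof (induction k)
    case 0
    show ?case unfolding g_def by (simp, rule few_spins.base[of A]) (use A f in \<open>auto simp: n_def\<close>)
  next
    case (Suc k)
    from few_spins_uniformised_step[OF this N] show ?case by (simp add: g_def step_def)
  qed
  then have cyl: "cylinder (g k)" for k by (rule few_spins_cylinder)
  define a where "a k t = transition_op K t (g k) \<eta>" for k t
  have "((\<lambda>t. a 0 (t + h) - a 0 t) \<longlongrightarrow> 0) at_top"
  proof (rule poissonised_sequence_asymptotically_constant[OF N(1) h])
    fix k and u :: real
    assume u: "u > 0"
    have "pregenerator E s (g k) = (\<lambda>\<zeta>. N * (g (Suc k) \<zeta> - g k \<zeta>))"
      using N by (auto simp: g_def step_def)
    then have "transition_op K u (pregenerator E s (g k)) \<eta> = N * (a (Suc k) u - a k u)"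
      using u by (simp only: transition_op_scale)
        (simp add: transition_op_diff cyl cylinder_continuous \<eta> a_def)
    then show "(a k has_real_derivative N * (a (Suc k) u - a k u)) (at u)"
      using transition_op_has_derivative[OF cylinder_in_generator[OF cyl] u \<eta>, of k]
      by (simp add: a_def[abs_def])
  next
    fix k and u :: real
    assume "u \<ge> 0"
    then show "\<bar>a k u\<bar> \<le> c"
      unfolding a_def
      by (intro transition_op_bound cylinder_continuous cyl \<eta> few_spins_bound[OF few])
  qed
  then show ?thesis by (simp add: a_def g_def)
qed

text \<open>Along the times \<open>T n\<close>, the expectations of \<open>f\<close> at time \<open>T n + h\<close> tend to \<open>\<integral> U\<^sub>h f d\<nu>\<close> by the Feller
  property, and those at time \<open>T n\<close> to \<open>\<integral> f d\<nu>\<close>. Their differences vanish in the limit.\<close>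

lemma limit_of_laws_is_equilibrium:
  assumes \<eta>: "\<eta> \<in> configs" and \<nu>: "\<nu> \<in> space (prob_algebra config_space)"
    and T: "filterlim T at_top sequentially" "\<And>n. T n \<ge> 0"
    and lim: "\<And>f :: ('v \<Rightarrow> real) \<Rightarrow> real. continuous_on configs f \<Longrightarrow> (\<lambda>n. \<integral>\<zeta>. f \<zeta> \<partial>K (T n) \<eta>) \<longlonglongrightarrow> (\<integral>\<zeta>. f \<zeta> \<partial>\<nu>)"
  shows "equilibrium K \<nu>"
  unfolding equilibrium_def
proof (intro conjI allI impI \<nu>)
  fix h :: real assume h: "h \<ge> 0"
  have s: "sets \<nu> = sets config_space" using \<nu> by (simp add: space_prob_algebra)
  have bind: "\<nu> \<bind> K h \<in> space (prob_algebra config_space)"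
    using prob_space_bind'[OF \<nu> kernel[OF h]] sets_bind'[OF \<nu> kernel[OF h]] by (simp add: space_prob_algebra)
  show "\<nu> \<bind> K h = \<nu>"
  proof (rule laws_eqI[OF bind \<nu>])
    fix f :: "('v \<Rightarrow> real) \<Rightarrow> real"
    assume cyl: "cylinder f" and bdd: "\<And>\<zeta>. \<bar>f \<zeta>\<bar> \<le> 1"
    note f = cylinder_continuous[OF cyl]
    have "(\<lambda>n. transition_op K (T n + h) f \<eta>) \<longlonglongrightarrow> (\<integral>\<zeta>. transition_op K h f \<zeta> \<partial>\<nu>)"
      using lim[OF transition_op_continuous[OF f h]]
      by (simp add: transition_op_add[OF f T(2) h \<eta>] transition_op_def[of K "T _"])
    from tendsto_diff[OF this lim[OF f]]
    have "(\<lambda>n. transition_op K (T n + h) f \<eta> - transition_op K (T n) f \<eta>)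
        \<longlonglongrightarrow> (\<integral>\<zeta>. transition_op K h f \<zeta> \<partial>\<nu>) - (\<integral>\<zeta>. f \<zeta> \<partial>\<nu>)"
      by (simp add: transition_op_def[of K "T _"])
    moreover have "(\<lambda>n. transition_op K (T n + h) f \<eta> - transition_op K (T n) f \<eta>) \<longlonglongrightarrow> 0"
      by (rule filterlim_compose[OF transition_op_asymptotically_constant[OF cyl bdd h \<eta>] T(1)])
    ultimately have "(\<integral>\<zeta>. transition_op K h f \<zeta> \<partial>\<nu>) - (\<integral>\<zeta>. f \<zeta> \<partial>\<nu>) = 0"
      by (rule LIMSEQ_unique)
    then show "(\<integral>\<zeta>. f \<zeta> \<partial>(\<nu> \<bind> K h)) = (\<integral>\<zeta>. f \<zeta> \<partial>\<nu>)"
      by (simp add: integral_bind_kernel[OF \<nu> f h])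
  qed
qed

lemma converges_if_unique_equilibrium:
  assumes unique: "\<And>\<nu>. equilibrium K \<nu> \<Longrightarrow> \<nu> = \<mu>" and \<eta>: "\<eta> \<in> configs"
  shows "converges_in_distribution (\<lambda>t. K t \<eta>) \<mu>"
  unfolding converges_in_distribution_def
proof (intro allI impI, elim conjE)
  fix f :: "('v \<Rightarrow> real) \<Rightarrow> real" assume f: "continuous_on configs f"
  show "((\<lambda>t. \<integral>\<zeta>. f \<zeta> \<partial>K t \<eta>) \<longlongrightarrow> (\<integral>\<zeta>. f \<zeta> \<partial>\<mu>)) at_top"
  proof (rule tendsto_at_topI_sequentially, rule LIMSEQ_if_subsequences)
    fix X :: "nat \<Rightarrow> real" and r :: "nat \<Rightarrow> nat"
    assume X: "filterlim X at_top sequentially" and r: "strict_mono r"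
    \<comment> \<open>The laws are meaningful at nonnegative times only, and \<open>X\<close> is eventually nonnegative.\<close>
    define T where "T n = max 0 (X (r n))" for n
    obtain q \<nu> where q: "strict_mono q" and \<nu>: "\<nu> \<in> space (prob_algebra config_space)"
      and lim: "\<And>f :: ('v \<Rightarrow> real) \<Rightarrow> real. continuous_on configs f \<Longrightarrow>
         (\<lambda>n. \<integral>\<zeta>. f \<zeta> \<partial>K (T (q n)) \<eta>) \<longlonglongrightarrow> (\<integral>\<zeta>. f \<zeta> \<partial>\<nu>)"
      using laws_sequentially_compact[of "\<lambda>n. K (T n) \<eta>"] kernel_law[OF _ \<eta>] by (auto simp: T_def)
    have Xrq: "filterlim (\<lambda>n. X (r (q n))) at_top sequentially"
      using filterlim_compose[OF X filterlim_subseq[OF strict_mono_o[OF r q]]] by (simp add: o_def)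
    then have "filterlim (\<lambda>n. T (q n)) at_top sequentially"
      by (rule filterlim_at_top_mono) (simp add: T_def)
    then have \<nu>_eq: "\<nu> = \<mu>"
      by (intro unique limit_of_laws_is_equilibrium[OF \<eta> \<nu> _ _ lim]) (auto simp: T_def)
    have "\<forall>\<^sub>F n in sequentially. T (q n) = X (r (q n))"
      using Xrq[THEN filterlim_at_top[THEN iffD1], THEN spec, of 0]
      by eventually_elim (simp add: T_def)
    then have "\<forall>\<^sub>F n in sequentially. (\<integral>\<zeta>. f \<zeta> \<partial>K (T (q n)) \<eta>) = (\<integral>\<zeta>. f \<zeta> \<partial>K (X (r (q n))) \<eta>)"
      by eventually_elim simp
    from Lim_transform_eventually[OF lim[OF f] this] q
    show "\<exists>q :: nat \<Rightarrow> nat. strict_mono q \<and> (\<lambda>n. \<integral>\<zeta>. f \<zeta> \<partial>K (X (r (q n))) \<eta>) \<longlonglongrightarrow> (\<integral>\<zeta>. f \<zeta> \<partial>\<mu>)"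
      unfolding \<nu>_eq by blast
  qed
qed

end

section \<open>Uniqueness of the equilibrium implies ergodicity\<close>

theorem theorem1:
  fixes E :: "('v::countable) set set"
    and s :: "'v set \<Rightarrow> real"
    and K :: "'v transition"
  assumes "locally_finite_graph E"
    and "sign_function E s"
    and "signed_voter_model E s K"
    and "\<exists>!\<mu>. equilibrium K \<mu>"
  shows "ergodic K"
proof -
  interpret signed_voter_process E s K by unfold_locales (fact assms)+
  from assms(4) obtain \<mu> where \<mu>: "equilibrium K \<mu>" and unique: "\<And>\<nu>. equilibrium K \<nu> \<Longrightarrow> \<nu> = \<mu>" by blast
  then show ?thesis unfolding ergodic_def using converges_if_unique_equilibrium[OF unique] by blast
qed

end
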